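(* Let $(X,\to,0,1)$ be an implicative-orthomodular algebra. Then $X$ is a quantum-Wajsberg algebra if and only if for all $x,y\in X$, $$(x\Cap y)\to (y\Cap x)=1.$$
   Context: A BE algebra is an algebra $(X,\to,1)$ of type $(2,0)$ such that for all $x,y,z\in X$: $x\to x=1$; $x\to 1=1$; $1\to x=x$; $x\to(y\to z)=y\to(x\to z)$. Put $x\le y$ iff $x\to y=1$. It is bounded if there is $0\in X$ with $0\le x$ for all $x\in X$; then $x^*:=x\to 0$. It is involutive if it is bounded and $x^{**}=x$ for all $x$. In an involutive BE algebra $(X,\to,0,1)$ define $x\Cap y:=((x^*\to y^* )\to y^* )^*$. An implicative-orthomodular algebra (IOM algebra) is an involutive BE algebra satisfying $x\Cap(y\to x)=x$ for all $x,y\in X$. A quantum-Wajsberg algebra (QW algebra) is an involutive BE algebra satisfying $x\to ((x\Cap y)\Cap (z\Cap x))=(x\to y)\Cap (x\to z)$ for all $x,y,z\in X$; equivalently, satisfying both $x\to(x\Cap y)=x\to y$ and $x\to (y\Cap (z\Cap x))=(x\to y)\Cap (x\to z)$ for all $x,y,z\in X$. *)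

theory Defs
  imports Main
begin

text \<open>
  An algebra is given by a carrier set X, an operation imp and constants zero and one.
  In an involutive BE algebra the bottom element is unique
  (if z is another one, then z = (z \<rightarrow> 0) \<rightarrow> 0 = 1 \<rightarrow> 0 = 0), so taking zero as part of the
  signature, as in (X, \<rightarrow>, 0, 1), involves no choice.
\<close>

locale be_algebra =
  fixes X :: "'a set"
    and imp :: "'a \<Rightarrow> 'a \<Rightarrow> 'a"  (infixr "\<leadsto>" 65)
    and one :: "'a"
  assumes imp_closed: "x \<in> X \<Longrightarrow> y \<in> X \<Longrightarrow> x \<leadsto> y \<in> X"
    and one_closed: "one \<in> X"
    and imp_self: "x \<in> X \<Longrightarrow> x \<leadsto> x = one"
    and imp_one: "x \<in> X \<Longrightarrow> x \<leadsto> one = one"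
    and one_imp: "x \<in> X \<Longrightarrow> one \<leadsto> x = x"
    and imp_exchange: "x \<in> X \<Longrightarrow> y \<in> X \<Longrightarrow> z \<in> X \<Longrightarrow> x \<leadsto> (y \<leadsto> z) = y \<leadsto> (x \<leadsto> z)"

definition be_le :: "('a \<Rightarrow> 'a \<Rightarrow> 'a) \<Rightarrow> 'a \<Rightarrow> 'a \<Rightarrow> 'a \<Rightarrow> bool" where
  "be_le imp one x y \<longleftrightarrow> imp x y = one"

definition be_star :: "('a \<Rightarrow> 'a \<Rightarrow> 'a) \<Rightarrow> 'a \<Rightarrow> 'a \<Rightarrow> 'a" where
  "be_star imp zero x = imp x zero"

definition be_cap :: "('a \<Rightarrow> 'a \<Rightarrow> 'a) \<Rightarrow> 'a \<Rightarrow> 'a \<Rightarrow> 'a \<Rightarrow> 'a" where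
  "be_cap imp zero x y =
     be_star imp zero
       (imp (imp (be_star imp zero x) (be_star imp zero y)) (be_star imp zero y))"

locale bounded_be_algebra = be_algebra X imp one
  for X :: "'a set" and imp :: "'a \<Rightarrow> 'a \<Rightarrow> 'a"  (infixr "\<leadsto>" 65) and zero one :: "'a" +
  assumes zero_closed: "zero \<in> X"
    and zero_le: "x \<in> X \<Longrightarrow> be_le (\<leadsto>) one zero x"

locale involutive_be_algebra = bounded_be_algebra X imp zero one
  for X :: "'a set" and imp :: "'a \<Rightarrow> 'a \<Rightarrow> 'a"  (infixr "\<leadsto>" 65) and zero one :: "'a" +
  assumes star_star: "x \<in> X \<Longrightarrow> be_star (\<leadsto>) zero (be_star (\<leadsto>) zero x) = x"
begin

abbreviation cap :: "'a \<Rightarrow> 'a \<Rightarrow> 'a"  (infixl "\<Cap>" 70) where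
  "x \<Cap> y \<equiv> be_cap (\<leadsto>) zero x y"

end

locale iom_algebra = involutive_be_algebra X imp zero one
  for X :: "'a set" and imp :: "'a \<Rightarrow> 'a \<Rightarrow> 'a"  (infixr "\<leadsto>" 65) and zero one :: "'a" +
  assumes iom: "x \<in> X \<Longrightarrow> y \<in> X \<Longrightarrow> x \<Cap> (y \<leadsto> x) = x"

locale qw_algebra = involutive_be_algebra X imp zero one
  for X :: "'a set" and imp :: "'a \<Rightarrow> 'a \<Rightarrow> 'a"  (infixr "\<leadsto>" 65) and zero one :: "'a" +
  assumes qw: "x \<in> X \<Longrightarrow> y \<in> X \<Longrightarrow> z \<in> X \<Longrightarrow>
    x \<leadsto> ((x \<Cap> y) \<Cap> (z \<Cap> x)) = (x \<leadsto> y) \<Cap> (x \<leadsto> z)"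

end

theory Submission
  imports Defs
begin

text \<open>
  Everything becomes transparent in additive notation \<open>x \<oplus> y = x\<^sup>* \<leadsto> y\<close>,
  \<open>x \<odot> y = (x\<^sup>* \<oplus> y\<^sup>*)\<^sup>*\<close>. In an involutive BE algebra \<open>\<oplus>\<close> is commutative and associative,
  and \<open>x \<Cap> y = (x \<oplus> y\<^sup>*) \<odot> y\<close>, as in quantum MV algebras. Write \<open>x \<sqsubseteq> y\<close> for \<open>x \<Cap> y = x\<close>.

  The IOM axiom reads \<open>x \<sqsubseteq> x \<oplus> t\<close>, and it makes \<open>\<sqsubseteq>\<close> the divisibility order of \<open>\<oplus>\<close>:
  \<open>x \<sqsubseteq> y\<close> iff \<open>y = x \<oplus> t\<close> for some \<open>t\<close> (\<open>le_iff_oplus\<close>). Hence \<open>\<sqsubseteq>\<close> is transitive, is reversed by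
  the star, and \<open>\<oplus>\<close>, \<open>\<odot>\<close>, \<open>\<Cap>\<close> are monotone in their left arguments. Moreover the orthomodular
  law \<open>x \<oplus> (x\<^sup>* \<odot> y) = y\<close> holds for \<open>x \<sqsubseteq> y\<close> (\<open>orthomodular\<close>). These two facts already give, in every
  IOM algebra, one half of the quantum-Wajsberg axiom, namely
  \<open>x \<leadsto> (y \<Cap> (z \<Cap> x)) = (x \<leadsto> y) \<Cap> (x \<leadsto> z)\<close> (\<open>imp_cap_cap\<close>). So an IOM algebra is quantum-Wajsberg
  iff the other half, \<open>x \<leadsto> (x \<Cap> y) = x \<leadsto> y\<close>, holds (\<open>qw_iff_imp_cap\<close>).

  It remains to compare this identity with \<open>(y \<Cap> x) \<leadsto> (x \<Cap> y) = 1\<close>. Unfolding the left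
  factor only, the latter says \<open>(x \<leadsto> y) \<leadsto> (x \<leadsto> (x \<Cap> y)) = 1\<close> (\<open>cap_imp_cap\<close>), so it follows from
  the identity. Conversely, \<open>x \<Cap> y \<sqsubseteq> y\<close> gives \<open>x \<leadsto> (x \<Cap> y) \<sqsubseteq> x \<leadsto> y\<close> by monotonicity, and
  \<open>b \<sqsubseteq> a\<close> together with \<open>a \<leadsto> b = 1\<close> forces \<open>b = (b \<oplus> a\<^sup>*) \<odot> a = 1 \<odot> a = a\<close>.
\<close>

section \<open>Additive notation in involutive BE algebras\<close>

context involutive_be_algebra
begin

definition star :: "'a \<Rightarrow> 'a"
  where "star x = be_star (\<leadsto>) zero x"

definition oplus :: "'a \<Rightarrow> 'a \<Rightarrow> 'a"  (infixl "\<oplus>" 68)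
  where "x \<oplus> y = star x \<leadsto> y"

definition odot :: "'a \<Rightarrow> 'a \<Rightarrow> 'a"  (infixl "\<odot>" 69)
  where "x \<odot> y = star (star x \<oplus> star y)"

definition le_cap :: "'a \<Rightarrow> 'a \<Rightarrow> bool"  (infix "\<sqsubseteq>" 50)
  where "x \<sqsubseteq> y \<longleftrightarrow> x \<Cap> y = x"

lemma star_closed [simp]: "x \<in> X \<Longrightarrow> star x \<in> X"
  by (simp add: star_def be_star_def imp_closed zero_closed)

lemma oplus_closed [simp]: "x \<in> X \<Longrightarrow> y \<in> X \<Longrightarrow> x \<oplus> y \<in> X"
  by (simp add: oplus_def imp_closed)

lemma odot_closed [simp]: "x \<in> X \<Longrightarrow> y \<in> X \<Longrightarrow> x \<odot> y \<in> X"
  by (simp add: odot_def)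

lemma star_invol [simp]: "x \<in> X \<Longrightarrow> star (star x) = x"
  by (simp add: star_def star_star)

lemma imp_eq_oplus: "x \<in> X \<Longrightarrow> x \<leadsto> y = star x \<oplus> y"
  by (simp add: oplus_def)

lemma star_oplus: "x \<in> X \<Longrightarrow> y \<in> X \<Longrightarrow> star (x \<oplus> y) = star x \<odot> star y"
  by (simp add: odot_def)

lemma star_odot: "x \<in> X \<Longrightarrow> y \<in> X \<Longrightarrow> star (x \<odot> y) = star x \<oplus> star y"
  by (simp add: odot_def)

text \<open>Commutativity is contraposition: write \<open>y = y\<^sup>* \<leadsto> 0\<close> and exchange the premises.\<close>

lemma oplus_commute:
  assumes "x \<in> X" "y \<in> X"
  shows "x \<oplus> y = y \<oplus> x"
proof -
  have "star x \<leadsto> y = star x \<leadsto> (star y \<leadsto> zero)"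
    using assms star_star[of y] by (simp add: star_def be_star_def)
  also have "\<dots> = star y \<leadsto> (star x \<leadsto> zero)"
    using assms by (simp add: imp_exchange zero_closed)
  also have "\<dots> = star y \<leadsto> x"
    using assms star_star[of x] by (simp add: star_def be_star_def)
  finally show ?thesis by (simp add: oplus_def)
qed

lemma oplus_left_commute:
  assumes "x \<in> X" "y \<in> X" "z \<in> X"
  shows "x \<oplus> (y \<oplus> z) = y \<oplus> (x \<oplus> z)"
  using assms by (simp add: oplus_def imp_exchange)

lemma oplus_assoc:
  assumes "x \<in> X" "y \<in> X" "z \<in> X"
  shows "(x \<oplus> y) \<oplus> z = x \<oplus> (y \<oplus> z)"
  using assms oplus_commute oplus_left_commute by (metis oplus_closed)

lemmas oplus_ac = oplus_assoc oplus_commute oplus_left_commute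

lemma odot_commute: "x \<in> X \<Longrightarrow> y \<in> X \<Longrightarrow> x \<odot> y = y \<odot> x"
  by (simp add: odot_def oplus_commute)

lemma odot_left_commute:
  "x \<in> X \<Longrightarrow> y \<in> X \<Longrightarrow> z \<in> X \<Longrightarrow> x \<odot> (y \<odot> z) = y \<odot> (x \<odot> z)"
  by (simp add: odot_def oplus_left_commute)

lemma star_one: "star one = zero"
  by (simp add: star_def be_star_def one_imp zero_closed)

lemma oplus_zero: "x \<in> X \<Longrightarrow> x \<oplus> zero = x"
  using star_invol[of x] by (simp add: oplus_def star_def be_star_def)

lemma one_oplus: "x \<in> X \<Longrightarrow> one \<oplus> x = one"
  using zero_le[of x] by (simp add: oplus_def star_one be_le_def)

lemma one_odot: "x \<in> X \<Longrightarrow> one \<odot> x = x"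
  by (simp add: odot_def star_one oplus_commute[of zero] oplus_zero zero_closed)

lemma cap_eq: "x \<in> X \<Longrightarrow> y \<in> X \<Longrightarrow> x \<Cap> y = (x \<oplus> star y) \<odot> y"
  by (simp add: be_cap_def odot_def oplus_def imp_closed flip: star_def)

lemma cap_closed [simp]: "x \<in> X \<Longrightarrow> y \<in> X \<Longrightarrow> x \<Cap> y \<in> X"
  by (simp add: cap_eq)

lemma cap_one: "x \<in> X \<Longrightarrow> x \<Cap> one = x"
  by (simp add: cap_eq one_closed star_one oplus_zero odot_commute[of _ one] one_odot)

lemma le_capD_eq:
  assumes "b \<sqsubseteq> a" "a \<leadsto> b = one" "a \<in> X" "b \<in> X"
  shows "b = a"
proof -
  have "b \<oplus> star a = one"
    using assms by (simp add: imp_eq_oplus oplus_commute)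
  then show ?thesis
    using assms by (simp add: le_cap_def cap_eq one_odot)
qed

text \<open>
  Only the left factor is unfolded, to \<open>(y \<Cap> x)\<^sup>* = (x \<leadsto> y)\<^sup>* \<oplus> x\<^sup>*\<close>. Thus the inequality between
  \<open>y \<Cap> x\<close> and \<open>x \<Cap> y\<close> is an inequality between \<open>x \<leadsto> y\<close> and \<open>x \<leadsto> (x \<Cap> y)\<close>.
\<close>

lemma cap_imp_cap:
  assumes "x \<in> X" "y \<in> X"
  shows "(y \<Cap> x) \<leadsto> (x \<Cap> y) = (x \<leadsto> y) \<leadsto> (x \<leadsto> (x \<Cap> y))"
proof -
  have "star (y \<Cap> x) = star (x \<leadsto> y) \<oplus> star x"
    using assms by (simp add: cap_eq star_odot imp_eq_oplus oplus_commute)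
  then show ?thesis
    using assms by (simp add: imp_eq_oplus oplus_assoc)
qed

end

section \<open>The order and the orthomodular law in IOM algebras\<close>

context iom_algebra
begin

lemma le_oplus: "x \<in> X \<Longrightarrow> t \<in> X \<Longrightarrow> x \<sqsubseteq> x \<oplus> t"
  using iom[of x "star t"] by (simp add: le_cap_def imp_eq_oplus oplus_commute)

text \<open>
  If \<open>x = (x \<oplus> y\<^sup>*) \<odot> y\<close>, then \<open>x\<^sup>*\<close> is a sum with summand \<open>y\<^sup>*\<close>, so the IOM axiom applies.
\<close>

lemma star_antimono:
  assumes "x \<sqsubseteq> y" "x \<in> X" "y \<in> X"
  shows "star y \<sqsubseteq> star x"
proof -
  have "star x = star (x \<oplus> star y) \<oplus> star y"
    using assms by (metis le_cap_def cap_eq star_odot oplus_closed star_closed)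
  also have "\<dots> = star y \<oplus> star (x \<oplus> star y)"
    using assms by (simp add: oplus_commute)
  finally show ?thesis
    using assms le_oplus[of "star y" "star (x \<oplus> star y)"] by simp
qed

text \<open>The law is the equation \<open>y\<^sup>* \<Cap> x\<^sup>* = y\<^sup>*\<close> with the star applied to both sides.\<close>

lemma orthomodular:
  assumes "x \<sqsubseteq> y" "x \<in> X" "y \<in> X"
  shows "x \<oplus> (star x \<odot> y) = y"
proof -
  have "star y = (star y \<oplus> x) \<odot> star x"
    using star_antimono[OF assms] assms by (simp add: le_cap_def cap_eq)
  then have "y = star (star y \<oplus> x) \<oplus> x"
    using assms by (metis star_odot star_invol star_closed oplus_closed)
  also have "\<dots> = (y \<odot> star x) \<oplus> x"
    using assms by (simp add: star_oplus)
  also have "\<dots> = x \<oplus> (star x \<odot> y)"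
    using assms by (simp add: oplus_commute odot_commute)
  finally show ?thesis by simp
qed

lemma le_iff_oplus:
  assumes "x \<in> X" "y \<in> X"
  shows "x \<sqsubseteq> y \<longleftrightarrow> (\<exists>t\<in>X. y = x \<oplus> t)"
proof
  assume "x \<sqsubseteq> y"
  then have "y = x \<oplus> (star x \<odot> y)"
    using orthomodular[OF _ assms] by simp
  moreover have "star x \<odot> y \<in> X" using assms by simp
  ultimately show "\<exists>t\<in>X. y = x \<oplus> t" by blast
qed (use assms le_oplus in auto)

lemma oplus_mono:
  assumes "x \<sqsubseteq> y" "x \<in> X" "y \<in> X" "z \<in> X"
  shows "x \<oplus> z \<sqsubseteq> y \<oplus> z"
proof -
  obtain t where t: "t \<in> X" "y = x \<oplus> t"
    using assms le_iff_oplus by blast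
  then have "y \<oplus> z = (x \<oplus> z) \<oplus> t"
    using assms by (simp add: oplus_ac)
  then show ?thesis
    using assms t by (simp add: le_oplus)
qed

lemma odot_mono:
  assumes "x \<sqsubseteq> y" "x \<in> X" "y \<in> X" "z \<in> X"
  shows "x \<odot> z \<sqsubseteq> y \<odot> z"
  using assms by (simp add: odot_def star_antimono oplus_mono)

lemma cap_mono:
  assumes "x \<sqsubseteq> y" "x \<in> X" "y \<in> X" "z \<in> X"
  shows "x \<Cap> z \<sqsubseteq> y \<Cap> z"
  using assms by (simp add: cap_eq oplus_mono odot_mono)

lemma cap_le_right:
  assumes "x \<in> X" "y \<in> X"
  shows "x \<Cap> y \<sqsubseteq> y"
proof -
  have "star y \<sqsubseteq> star y \<oplus> star (x \<oplus> star y)"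
    using assms by (simp add: le_oplus)
  then have "star (star y \<oplus> star (x \<oplus> star y)) \<sqsubseteq> y"
    using star_antimono[of "star y"] assms by fastforce
  then show ?thesis
    using assms by (simp add: cap_eq odot_commute flip: odot_def)
qed

section \<open>The two halves of the quantum-Wajsberg axiom\<close>

text \<open>
  With \<open>s = x \<leadsto> y\<close> and \<open>d = x \<leadsto> z\<close>, unfolding gives \<open>y \<Cap> (z \<Cap> x) = x \<odot> (s \<Cap> d)\<close>. Since
  \<open>x\<^sup>* \<sqsubseteq> s\<close> and \<open>x\<^sup>* \<sqsubseteq> d\<close>, monotonicity yields \<open>x\<^sup>* = x\<^sup>* \<Cap> d \<sqsubseteq> s \<Cap> d\<close>, and the orthomodular law
  recovers \<open>s \<Cap> d\<close> from \<open>x \<odot> (s \<Cap> d)\<close>.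
\<close>

lemma imp_cap_cap:
  assumes "x \<in> X" "y \<in> X" "z \<in> X"
  shows "x \<leadsto> (y \<Cap> (z \<Cap> x)) = (x \<leadsto> y) \<Cap> (x \<leadsto> z)"
proof -
  define s d where "s = x \<leadsto> y" and "d = x \<leadsto> z"
  have sd: "s = star x \<oplus> y" "d = star x \<oplus> z" "s \<in> X" "d \<in> X"
    using assms by (simp_all add: s_def d_def imp_eq_oplus)
  have w: "z \<Cap> x = x \<odot> d"
    using assms by (simp add: cap_eq sd oplus_commute odot_commute)
  have "y \<oplus> star (x \<odot> d) = s \<oplus> star d"
    using assms \<open>d \<in> X\<close> by (simp add: star_odot sd(1) oplus_ac)
  then have "y \<Cap> (z \<Cap> x) = (s \<oplus> star d) \<odot> (x \<odot> d)"
    using assms sd(4) by (simp add: w cap_eq)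
  also have "\<dots> = x \<odot> (s \<Cap> d)"
    using assms sd(3,4) by (simp add: cap_eq odot_left_commute)
  finally have cap: "y \<Cap> (z \<Cap> x) = x \<odot> (s \<Cap> d)" .
  have "star x \<sqsubseteq> s" "star x \<sqsubseteq> d"
    using assms by (simp_all add: sd le_oplus)
  then have "star x \<sqsubseteq> s \<Cap> d"
    using cap_mono[of "star x" s d] assms sd(3,4) by (simp add: le_cap_def)
  then have "star x \<oplus> (x \<odot> (s \<Cap> d)) = s \<Cap> d"
    using orthomodular[of "star x" "s \<Cap> d"] assms sd(3,4) by simp
  then show ?thesis
    using assms by (simp add: cap imp_eq_oplus flip: s_def d_def)
qed

text \<open>
  By the preceding identity, the left-hand side of the quantum-Wajsberg axiom is always
  \<open>(x \<leadsto> (x \<Cap> y)) \<Cap> (x \<leadsto> z)\<close>; the choice \<open>z = 1\<close> then isolates \<open>x \<leadsto> (x \<Cap> y) = x \<leadsto> y\<close>.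
\<close>

lemma qw_iff_imp_cap:
  "qw_algebra X (\<leadsto>) zero one \<longleftrightarrow> (\<forall>x\<in>X. \<forall>y\<in>X. x \<leadsto> (x \<Cap> y) = x \<leadsto> y)"
proof (intro iffI ballI)
  fix x y
  assume qw: "qw_algebra X (\<leadsto>) zero one" and "x \<in> X" "y \<in> X"
  then have "(x \<leadsto> (x \<Cap> y)) \<Cap> (x \<leadsto> one) = (x \<leadsto> y) \<Cap> (x \<leadsto> one)"
    using qw_algebra.qw[OF qw, of x y one] one_closed
    by (simp add: imp_cap_cap)
  then show "x \<leadsto> (x \<Cap> y) = x \<leadsto> y"
    using \<open>x \<in> X\<close> \<open>y \<in> X\<close> by (simp add: imp_one cap_one imp_closed)
next
  assume half: "\<forall>x\<in>X. \<forall>y\<in>X. x \<leadsto> (x \<Cap> y) = x \<leadsto> y"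
  show "qw_algebra X (\<leadsto>) zero one"
    by unfold_locales (simp add: imp_cap_cap half)
qed

text \<open>
  Always \<open>x \<leadsto> (x \<Cap> y) \<sqsubseteq> x \<leadsto> y\<close>, by monotonicity, so equality amounts to the reverse
  inequality, and already to the weak one expressed by \<open>\<leadsto>\<close>.
\<close>

lemma imp_cap_iff_cap_imp_cap:
  assumes "x \<in> X" "y \<in> X"
  shows "x \<leadsto> (x \<Cap> y) = x \<leadsto> y \<longleftrightarrow> (y \<Cap> x) \<leadsto> (x \<Cap> y) = one"
proof
  assume "x \<leadsto> (x \<Cap> y) = x \<leadsto> y"
  then show "(y \<Cap> x) \<leadsto> (x \<Cap> y) = one"
    using assms by (simp add: cap_imp_cap imp_self imp_closed)
next
  assume "(y \<Cap> x) \<leadsto> (x \<Cap> y) = one"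
  then have weak: "(x \<leadsto> y) \<leadsto> (x \<leadsto> (x \<Cap> y)) = one"
    using assms by (simp add: cap_imp_cap)
  have "x \<leadsto> (x \<Cap> y) \<sqsubseteq> x \<leadsto> y"
    using oplus_mono[OF cap_le_right[OF assms], of "star x"] assms
    by (simp add: imp_eq_oplus oplus_commute)
  from le_capD_eq[OF this weak] show "x \<leadsto> (x \<Cap> y) = x \<leadsto> y"
    using assms by (simp add: imp_closed)
qed

end

theorem theorem3p12:
  fixes X :: "'a set"
    and imp :: "'a \<Rightarrow> 'a \<Rightarrow> 'a"
    and zero one :: "'a"
  assumes "iom_algebra X imp zero one"
  shows "qw_algebra X imp zero one \<longleftrightarrow>
    (\<forall>x\<in>X. \<forall>y\<in>X. imp (be_cap imp zero x y) (be_cap imp zero y x) = one)"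
proof -
  interpret iom_algebra X imp zero one by (rule assms)
  show ?thesis
    using qw_iff_imp_cap imp_cap_iff_cap_imp_cap by blast
qed

end
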